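(* Let $S=(1,s_2,s_3,\ldots)$ be a packing sequence and $P_n$ a path of order $n\ge 1$. (i) If there exists an index $i$ with $s_i < 2^{i-1}$, and $k=\min\{i : s_i<2^{i-1}\}$, then $\chi_S(P_n) \ge \min\{k, \lfloor \log_2(n)\rfloor + 1\}$. (ii) If $2^{i-1} \le s_i < 2^i$ holds for every $2 \le i \le \lfloor \log_2(n)\rfloor + 1$, then $\chi_S(P_n) = \lfloor \log_2(n)\rfloor + 1$. (iii) If $2^{i-1} \le s_i$ holds for every $2 \le i \le \lfloor \log_2(n)\rfloor + 1$, then $\chi_S(P_n) \ge \lfloor \log_2(n)\rfloor + 1$.
   Context: A packing sequence is a non-decreasing infinite sequence $S=(s_1,s_2,\ldots)$ of positive integers. For a graph $G$, a map $\phi\colon V(G)\to\{1,\ldots,k\}$ is an $S$-packing $k$-coloring if any two distinct vertices $u,v$ with $\phi(u)=\phi(v)=i$ satisfy $d_G(u,v) > s_i$. The $S$-packing chromatic number $\chi_S(G)$ is the least $k$ for which such a coloring exists. $P_n$ denotes the path on $n$ vertices. *)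

theory Defs
  imports "HOL-Analysis.Analysis" "Graph_Theory.Graph_Theory"
begin

text \<open>
  Undirected graphs are the symmetric digraphs of \<^locale>\<open>graph\<close>. The distance is the
  library's shortest-path cost for unit arc weights; it is infinite between vertices that
  are not joined by a walk.
\<close>

definition graph_dist :: "('a, 'b) pre_digraph \<Rightarrow> 'a \<Rightarrow> 'a \<Rightarrow> ereal" where
  "graph_dist G u v = wf_digraph.\<mu> G (\<lambda>_. 1) u v"

definition path_graph :: "nat \<Rightarrow> (nat, nat \<times> nat) pre_digraph" where
  "path_graph n = with_proj
     \<lparr> pverts = {1..n},
       parcs = {(u, v). u \<in> {1..n} \<and> v \<in> {1..n} \<and> (v = u + 1 \<or> u = v + 1)} \<rparr>"

lemma graph_path_graph: "graph (path_graph n)"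
proof -
  have "finite {(u, v). u \<in> {1..n} \<and> v \<in> {1..n} \<and> (v = u + 1 \<or> u = v + 1)}"
    by (rule finite_subset[of _ "{1..n} \<times> {1..n}"]) auto
  then show ?thesis
    unfolding path_graph_def
    by unfold_locales (auto simp: arc_to_ends_def symmetric_def sym_def)
qed

text \<open>
  A sequence $(s_1, s_2, \ldots)$ is a function on the naturals, used only at indices
  at least 1; the value at 0 is irrelevant.
\<close>

definition packing_sequence :: "(nat \<Rightarrow> nat) \<Rightarrow> bool" where
  "packing_sequence s \<longleftrightarrow> (\<forall>i\<ge>1. 0 < s i) \<and> mono_on {1..} s"

definition packing_coloring ::
    "(nat \<Rightarrow> nat) \<Rightarrow> ('a, 'b) pre_digraph \<Rightarrow> nat \<Rightarrow> ('a \<Rightarrow> nat) \<Rightarrow> bool" where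
  "packing_coloring s G k \<phi> \<longleftrightarrow>
     \<phi> \<in> verts G \<rightarrow> {1..k} \<and>
     (\<forall>u\<in>verts G. \<forall>v\<in>verts G. \<forall>i. u \<noteq> v \<and> \<phi> u = i \<and> \<phi> v = i \<longrightarrow>
        ereal (real (s i)) < graph_dist G u v)"

text \<open>
  The least element below is meaningful only if some such coloring exists; this is the case for
  every finite graph, since all vertices may get different colors.
\<close>

definition packing_chromatic_number ::
    "(nat \<Rightarrow> nat) \<Rightarrow> ('a, 'b) pre_digraph \<Rightarrow> nat" where
  "packing_chromatic_number s G = (LEAST k. \<exists>\<phi>. packing_coloring s G k \<phi>)"

lemma packing_coloring_exists:
  assumes "finite (verts G)"
  shows "\<exists>k \<phi>. packing_coloring s G k \<phi>"
proof -
  obtain f where f: "bij_betw f (verts G) {1..card (verts G)}"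
    using finite_same_card_bij[OF assms, of "{1..card (verts G)}"] by auto
  then have "packing_coloring s G (card (verts G)) f"
    unfolding packing_coloring_def
    by (blast dest: bij_betw_apply bij_betw_imp_inj_on inj_onD)
  then show ?thesis by blast
qed

end

theory Submission
  imports Defs
begin

text \<open>
  Lower bound: if \<open>s\<^sub>i \<ge> 2\<^bsup>i-1\<^esup>\<close> for all \<open>i \<le> k\<close>, then \<open>2\<^sup>k\<close> consecutive vertices cannot be
  colored with \<open>k\<close> colors. By induction every run of \<open>2\<^bsup>k-1\<^esup>\<close> vertices contains color \<open>k\<close>; the first
  half contains it at some \<open>u\<close>, and so does the run starting at \<open>u + 1\<close>, which gives two vertices of
  color \<open>k\<close> at distance at most \<open>2\<^bsup>k-1\<^esup>\<close>.
  Upper bound: color \<open>v\<close> with one plus its 2-adic valuation; then vertices of color \<open>i\<close> are at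
  distance at least \<open>2\<^sup>i\<close>.
\<close>

lemma path_graph_simps [simp]:
  "verts (path_graph n) = {1..n}"
  "(u, v) \<in> arcs (path_graph n) \<longleftrightarrow> u \<in> {1..n} \<and> v \<in> {1..n} \<and> (v = u + 1 \<or> u = v + 1)"
  "tail (path_graph n) = fst" "head (path_graph n) = snd"
  by (auto simp: path_graph_def)

lemma graph_dist_path_graph_le:
  assumes "1 \<le> u" "u \<le> v" "v \<le> n"
  shows "graph_dist (path_graph n) u v \<le> ereal (real (v - u))"
proof -
  interpret graph "path_graph n" by (rule graph_path_graph)
  have "\<exists>p. awalk u p v \<and> awalk_cost (\<lambda>_. 1) p = real (v - u)"
    using assms(2,1,3)
  proof (induction u rule: inc_induct)
    case base
    then show ?case by (intro exI[of _ "[]"]) (simp add: awalk_Nil_iff)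
  next
    case (step u)
    then obtain p where p: "awalk (Suc u) p v" "awalk_cost (\<lambda>_. 1) p = real (v - Suc u)"
      by auto
    with step show ?case
      by (intro exI[of _ "(u, Suc u) # p"]) (auto simp: awalk_Cons_iff of_nat_diff)
  qed
  then obtain p where "awalk u p v" "awalk_cost (\<lambda>_. 1) p = real (v - u)" by blast
  then show ?thesis
    unfolding graph_dist_def using min_cost_le_walk_cost[of u p v "\<lambda>_. 1"] by simp
qed

text \<open>Each arc changes the vertex by one, so every walk costs at least the displacement, and
  so does the infimum over walks. Where no walk exists, the infimum is infinite.\<close>

lemma graph_dist_path_graph_ge:
  "ereal \<bar>real u - real v\<bar> \<le> graph_dist (path_graph n) u v"
proof -
  interpret graph "path_graph n" by (rule graph_path_graph)
  have "\<bar>real u - real v\<bar> \<le> awalk_cost (\<lambda>_. 1) p" if "awalk u p v" for p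
    using that
  proof (induction p arbitrary: u)
    case Nil
    then show ?case by (simp add: awalk_Nil_iff)
  next
    case (Cons e p)
    obtain x w where e: "e = (x, w)" by (cases e)
    with Cons.prems have "awalk w p v" and [simp]: "x = u" and "w = u + 1 \<or> u = w + 1"
      by (auto simp: awalk_Cons_iff)
    with Cons.IH[of w] show ?case by auto
  qed
  then show ?thesis
    unfolding graph_dist_def \<mu>_def by (intro INF_greatest) simp
qed

text \<open>The start \<open>a\<close> is arbitrary because the induction passes to a half-length
  window at an unknown position. Positions are plain numbers here, so the pigeonhole argument stays
  free of graph distance.\<close>

lemma ex_close_same_color:
  fixes s \<phi> :: "nat \<Rightarrow> nat"
  assumes "\<And>i. 1 \<le> i \<Longrightarrow> i \<le> k \<Longrightarrow> 2 ^ (i - 1) \<le> s i"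
    and "\<And>x. x \<in> {a..<a + 2 ^ k} \<Longrightarrow> \<phi> x \<in> {1..k}"
  shows "\<exists>u v. a \<le> u \<and> u < v \<and> v < a + 2 ^ k \<and> \<phi> u = \<phi> v \<and> v - u \<le> s (\<phi> u)"
  using assms
proof (induction k arbitrary: a)
  case 0
  \<comment> \<open>The window is \<open>{a}\<close>, and the color of \<open>a\<close> would lie in
    the empty set.\<close>
  then show ?case by fastforce
next
  case (Suc k)
  \<comment> \<open>The starts \<open>b\<close> from \<open>a\<close> to \<open>a + 2 ^ k\<close>
    are exactly those whose half-length window fits into the big one. A window that avoids color
    \<open>Suc k\<close> uses only \<open>k\<close> colors, so the induction hypothesis applies to
    it.\<close>
  show ?case
  proof (cases "\<exists>b\<ge>a. b \<le> a + 2 ^ k \<and> (\<forall>x\<in>{b..<b + 2 ^ k}. \<phi> x \<noteq> Suc k)")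
    case True
    then obtain b where b: "a \<le> b" "b \<le> a + 2 ^ k" "\<forall>x\<in>{b..<b + 2 ^ k}. \<phi> x \<noteq> Suc k" by blast
    have "\<phi> x \<in> {1..k}" if "x \<in> {b..<b + 2 ^ k}" for x
      using Suc.prems(2)[of x] b that by fastforce
    with Suc.IH[of b] Suc.prems(1) obtain u v where
      "b \<le> u" "u < v" "v < b + 2 ^ k" "\<phi> u = \<phi> v" "v - u \<le> s (\<phi> u)"
      by auto
    with b show ?thesis by (intro exI[of _ u] exI[of _ v]) auto
  next
    case False
    then obtain u where u: "u \<in> {a..<a + 2 ^ k}" "\<phi> u = Suc k"
      by (meson le_add1 order_refl)
    \<comment> \<open>Since \<open>u\<close> lies in the first half, the window starting just after
      it still fits, so it contains color \<open>Suc k\<close> again, at some \<open>v\<close> with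
      \<open>v - u\<close> at most \<open>2 ^ k\<close>.\<close>
    then have "a \<le> u + 1" "u + 1 \<le> a + 2 ^ k" by auto
    with False obtain v where v: "v \<in> {u + 1..<u + 1 + 2 ^ k}" "\<phi> v = Suc k"
      by blast
    then have "v - u \<le> s (\<phi> u)"
      using u Suc.prems(1)[of "Suc k"] by auto
    with u v show ?thesis by (intro exI[of _ u] exI[of _ v]) auto
  qed
qed

lemma path_graph_no_packing_coloring:
  assumes "\<And>i. 1 \<le> i \<Longrightarrow> i \<le> k \<Longrightarrow> 2 ^ (i - 1) \<le> s i" and "2 ^ k \<le> n"
  shows "\<not> packing_coloring s (path_graph n) k \<phi>"
proof
  assume c: "packing_coloring s (path_graph n) k \<phi>"
  then have "\<phi> x \<in> {1..k}" if "x \<in> {1..<1 + 2 ^ k}" for x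
    using that assms(2) by (auto simp: packing_coloring_def Pi_iff)
  with assms(1) ex_close_same_color[of k s 1 \<phi>] obtain u v
    where uv: "1 \<le> u" "u < v" "v < 1 + 2 ^ k" "\<phi> u = \<phi> v" "v - u \<le> s (\<phi> u)"
    by auto
  then have "u \<in> verts (path_graph n)" "v \<in> verts (path_graph n)" "u \<noteq> v"
    using assms(2) by auto
  with c uv(4) have "ereal (real (s (\<phi> u))) < graph_dist (path_graph n) u v"
    unfolding packing_coloring_def by metis
  also have "\<dots> \<le> ereal (real (v - u))"
    using uv assms(2) by (intro graph_dist_path_graph_le) auto
  finally show False using uv by simp
qed

lemma packing_chromatic_number_coloring:
  assumes "finite (verts G)"
  obtains \<phi> where "packing_coloring s G (packing_chromatic_number s G) \<phi>"
  using LeastI_ex[OF packing_coloring_exists[OF assms, of s]]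
  unfolding packing_chromatic_number_def by blast

lemma packing_chromatic_number_path_graph_ge:
  assumes "\<And>i. 1 \<le> i \<Longrightarrow> i < m \<Longrightarrow> 2 ^ (i - 1) \<le> s i" and "2 ^ (m - 1) \<le> n"
  shows "m \<le> packing_chromatic_number s (path_graph n)"
proof (rule ccontr)
  define c where "c = packing_chromatic_number s (path_graph n)"
  assume "\<not> m \<le> packing_chromatic_number s (path_graph n)"
  then have "c < m" by (simp add: c_def)
  \<comment> \<open>Fewer than \<open>m\<close> colors need a run of at most
    \<open>2 ^ (m - 1)\<close> vertices for the contradiction, and the path has that many.\<close>
  then have "(2::nat) ^ c \<le> 2 ^ (m - 1)" by (intro power_increasing) auto
  with assms(2) have "2 ^ c \<le> n" by linarith
  with assms(1) \<open>c < m\<close> have "\<not> packing_coloring s (path_graph n) c \<phi>" for \<phi>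
    by (intro path_graph_no_packing_coloring) auto
  then show False
    using packing_chromatic_number_coloring[of "path_graph n" s] by (auto simp: c_def)
qed

text \<open>Both numbers are odd multiples of the same power of two, and distinct odd cofactors
  differ by at least 2. This gains the extra factor 2.\<close>

lemma multiplicity_2_eq_imp_diff_ge:
  fixes u v :: nat
  assumes "0 < u" "u < v" "multiplicity 2 u = multiplicity 2 v"
  shows "2 ^ (multiplicity 2 u + 1) \<le> v - u"
proof -
  obtain p where p: "u = 2 ^ multiplicity 2 u * p" "\<not> 2 dvd p"
    using multiplicity_decompose'[of u 2] assms by auto
  obtain q where q: "v = 2 ^ multiplicity 2 u * q" "\<not> 2 dvd q"
    using multiplicity_decompose'[of v 2] assms by auto
  have "p < q" using assms(2) p(1) q(1) by (metis mult_less_cancel1)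
  with p(2) q(2) have "2 \<le> q - p" by presburger
  then have "2 ^ multiplicity 2 u * 2 \<le> 2 ^ multiplicity 2 u * (q - p)" by simp
  also have "\<dots> = v - u" using p(1) q(1) by (metis diff_mult_distrib2)
  finally show ?thesis by simp
qed

lemma packing_coloring_multiplicity:
  assumes "\<And>i. 1 \<le> i \<Longrightarrow> i \<le> k \<Longrightarrow> s i < 2 ^ i" and "n < 2 ^ k"
  shows "packing_coloring s (path_graph n) k (\<lambda>v. multiplicity 2 v + 1)"
proof -
  let ?m = "multiplicity (2::nat)"
  have bound: "?m v + 1 \<le> k" if "v \<in> {1..n}" for v
  proof -
    have "2 ^ ?m v \<le> v" using that by (intro dvd_imp_le multiplicity_dvd) auto
    also have "v < 2 ^ k" using that assms(2) by simp
    finally show ?thesis by simp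
  qed
  have dist: "ereal (real (s (?m u + 1))) < graph_dist (path_graph n) u v"
    if uv: "u \<in> {1..n}" "v \<in> {1..n}" "u \<noteq> v" "?m u = ?m v" for u v
  proof -
    have "s (?m u + 1) < 2 ^ (?m u + 1)" using bound uv by (intro assms(1)) auto
    \<comment> \<open>\<open>max\<close> and \<open>min\<close> put the two vertices in the order
      that the divisibility lemma requires.\<close>
    moreover have "2 ^ (?m u + 1) \<le> max u v - min u v"
      using multiplicity_2_eq_imp_diff_ge[of u v] multiplicity_2_eq_imp_diff_ge[of v u] uv
      by (cases u v rule: linorder_cases) auto
    ultimately have "real (s (?m u + 1)) < \<bar>real u - real v\<bar>" by linarith
    then show ?thesis
      using graph_dist_path_graph_ge[of u v n] by (metis less_ereal.simps(1) order_less_le_trans)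
  qed
  show ?thesis
    unfolding packing_coloring_def path_graph_simps(1)
  proof (intro conjI ballI allI impI, goal_cases)
    case 1
    then show ?case using bound by auto
  next
    case (2 u v i)
    then show ?case using dist[of u v] by auto
  qed
qed

theorem theorem3p3:
  fixes s :: "nat \<Rightarrow> nat" and n :: nat
  assumes "packing_sequence s" and "s 1 = 1" and "n \<ge> 1"
  shows
    "(\<forall>k. (\<exists>i\<ge>1. s i < 2 ^ (i - 1)) \<and> k = (LEAST i. i \<ge> 1 \<and> s i < 2 ^ (i - 1)) \<longrightarrow>
        packing_chromatic_number s (path_graph n) \<ge> min k (nat \<lfloor>log 2 (real n)\<rfloor> + 1))
   \<and> ((\<forall>i. 2 \<le> i \<and> i \<le> nat \<lfloor>log 2 (real n)\<rfloor> + 1 \<longrightarrow> 2 ^ (i - 1) \<le> s i \<and> s i < 2 ^ i) \<longrightarrow>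
        packing_chromatic_number s (path_graph n) = nat \<lfloor>log 2 (real n)\<rfloor> + 1)
   \<and> ((\<forall>i. 2 \<le> i \<and> i \<le> nat \<lfloor>log 2 (real n)\<rfloor> + 1 \<longrightarrow> 2 ^ (i - 1) \<le> s i) \<longrightarrow>
        packing_chromatic_number s (path_graph n) \<ge> nat \<lfloor>log 2 (real n)\<rfloor> + 1)"
proof -
  define L where "L = nat \<lfloor>log 2 (real n)\<rfloor>"
  \<comment> \<open>\<open>2 ^ L\<close> is the largest power of two up to \<open>n\<close>: the
    first inequality serves the lower bounds, the second the coloring.\<close>
  have L: "2 ^ L \<le> n" "n < 2 ^ (L + 1)"
    using assms(3) floor_log_nat_eq_powr_iff[of 2 n L] by (simp_all add: L_def)
  have i: "min k (L + 1) \<le> packing_chromatic_number s (path_graph n)"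
    if "k = (LEAST i. i \<ge> 1 \<and> s i < 2 ^ (i - 1))" for k
  proof (rule packing_chromatic_number_path_graph_ge)
    \<comment> \<open>Indices below the least violating one satisfy the bound; capping at
      \<open>L + 1\<close> keeps the required run within the path.\<close>
    show "2 ^ (i - 1) \<le> s i" if "1 \<le> i" "i < min k (L + 1)" for i
      using not_less_Least[of i "\<lambda>i. i \<ge> 1 \<and> s i < 2 ^ (i - 1)"] that \<open>k = _\<close> by auto
    have "(2::nat) ^ (min k (L + 1) - 1) \<le> 2 ^ L" by (intro power_increasing) auto
    then show "2 ^ (min k (L + 1) - 1) \<le> n" using L(1) by (rule order_trans)
  qed
  have iii: "L + 1 \<le> packing_chromatic_number s (path_graph n)"
    if "\<forall>i. 2 \<le> i \<and> i \<le> L + 1 \<longrightarrow> 2 ^ (i - 1) \<le> s i"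
  proof (rule packing_chromatic_number_path_graph_ge)
    show "2 ^ (i - 1) \<le> s i" if "1 \<le> i" "i < L + 1" for i
      \<comment> \<open>The hypothesis starts at index 2; index 1 is covered by
        \<open>s 1 = 1\<close>, which equals \<open>2 ^ 0\<close>.\<close>
      using that \<open>\<forall>i. _\<close> assms(2) by (cases "i = 1") auto
  qed (use L in simp)
  have ii: "packing_chromatic_number s (path_graph n) = L + 1"
    if "\<forall>i. 2 \<le> i \<and> i \<le> L + 1 \<longrightarrow> 2 ^ (i - 1) \<le> s i \<and> s i < 2 ^ i"
  proof (rule antisym)
    have "s i < 2 ^ i" if "1 \<le> i" "i \<le> L + 1" for i
      using that \<open>\<forall>i. _\<close> assms(2) by (cases "i = 1") auto
    from packing_coloring_multiplicity[OF this L(2)]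
    show "packing_chromatic_number s (path_graph n) \<le> L + 1"
      unfolding packing_chromatic_number_def by (intro Least_le) blast
  qed (use that iii in blast)
  show ?thesis
    unfolding L_def[symmetric] using i ii iii by blast
qed

end
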